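(* Let $W_1$ and $W_2$ be two semi-orthogonal weighing matrices of order $m$. Then the signed graph with adjacency matrix $$\mathcal{A}(W_1,W_2)=\begin{pmatrix} O_m & W_1 & W_2\\ W_1^t & O_m & \frac12 W_1^tW_2\\ W_2^t & \frac12 W_2^tW_1 & O_m\end{pmatrix}$$ has spectrum $[4^m,(-2)^{2m}]$, i.e. its eigenvalues are $4$ with multiplicity $m$ and $-2$ with multiplicity $2m$.
   Context: A signed graph is a finite simple graph together with a sign function $\sigma$ on its edges with values in $\{1,-1\}$. Its adjacency matrix has $(i,j)$ entry $\sigma(v_iv_j)$ if $v_i,v_j$ are adjacent and $0$ otherwise; its spectrum is the spectrum of this matrix. A weighing matrix of order $m$ and weight $\alpha$ (a positive integer) is an $m\times m$ matrix $C$ with entries in $\{0,1,-1\}$ such that $CC^t=C^tC=\alpha I_m$. Two weighing matrices $W_1,W_2$ of order $m$, both of weight $4$, are called semi-orthogonal if every entry of $W_1^tW_2$ lies in $\{0,2,-2\}$. $O_m$ is the $m\times m$ zero matrix. *)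

theory Defs
  imports Complex_Main "Jordan_Normal_Form.Char_Poly"
begin

(* Edges are the unordered pairs {u, v}. The vertices are kept as a list v_1, ..., v_n,
   because the adjacency matrix depends on the order in which they are enumerated. *)
record 'v sgraph =
  vertices :: "'v list"
  edges :: "'v set set"
  edge_sign :: "'v set \<Rightarrow> int"

definition signed_graph :: "'v sgraph \<Rightarrow> bool" where
  "signed_graph G \<longleftrightarrow>
     distinct (vertices G) \<and>
     (\<forall>e \<in> edges G. \<exists>u v. u \<in> set (vertices G) \<and> v \<in> set (vertices G) \<and> u \<noteq> v \<and> e = {u, v}) \<and>
     (\<forall>e \<in> edges G. edge_sign G e \<in> {1, -1})"

(* The diagonal vanishes since the singleton {v, v} is not an edge. *)
definition adjacency_mat :: "'v sgraph \<Rightarrow> real mat" where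
  "adjacency_mat G = mat (length (vertices G)) (length (vertices G))
     (\<lambda>(i, j). let e = {vertices G ! i, vertices G ! j}
               in if e \<in> edges G then of_int (edge_sign G e) else 0)"

(* The complex eigenvalues, each repeated according to its algebraic multiplicity. *)
definition mat_spectrum :: "real mat \<Rightarrow> complex multiset" where
  "mat_spectrum A = proots (char_poly (map_mat complex_of_real A))"

definition graph_spectrum :: "'v sgraph \<Rightarrow> complex multiset" where
  "graph_spectrum G = mat_spectrum (adjacency_mat G)"

definition weighing_matrix :: "nat \<Rightarrow> nat \<Rightarrow> real mat \<Rightarrow> bool" where
  "weighing_matrix m \<alpha> C \<longleftrightarrow>
     \<alpha> > 0 \<and> C \<in> carrier_mat m m \<and> elements_mat C \<subseteq> {0, 1, -1} \<and>
     C * transpose_mat C = of_nat \<alpha> \<cdot>\<^sub>m 1\<^sub>m m \<and>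
     transpose_mat C * C = of_nat \<alpha> \<cdot>\<^sub>m 1\<^sub>m m"

definition semi_orthogonal :: "nat \<Rightarrow> real mat \<Rightarrow> real mat \<Rightarrow> bool" where
  "semi_orthogonal m W1 W2 \<longleftrightarrow>
     weighing_matrix m 4 W1 \<and> weighing_matrix m 4 W2 \<and>
     elements_mat (transpose_mat W1 * W2) \<subseteq> {0, 2, -2}"

(* Horizontal juxtaposition, the counterpart of append_rows. *)
definition append_cols :: "real mat \<Rightarrow> real mat \<Rightarrow> real mat" (infixr \<open>@\<^sub>c\<close> 66) where
  "A @\<^sub>c B = four_block_mat A B (0\<^sub>m 0 (dim_col A)) (0\<^sub>m 0 (dim_col B))"

definition block_adjacency :: "nat \<Rightarrow> real mat \<Rightarrow> real mat \<Rightarrow> real mat" where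
  "block_adjacency m W1 W2 =
     (0\<^sub>m m m @\<^sub>c W1 @\<^sub>c W2) @\<^sub>r
     (transpose_mat W1 @\<^sub>c 0\<^sub>m m m @\<^sub>c ((1/2) \<cdot>\<^sub>m (transpose_mat W1 * W2))) @\<^sub>r
     (transpose_mat W2 @\<^sub>c ((1/2) \<cdot>\<^sub>m (transpose_mat W2 * W1)) @\<^sub>c 0\<^sub>m m m)"

end

theory Submission
  imports Defs
begin

text \<open>
  Put \<open>C = (W\<^sub>1 | W\<^sub>2)\<close>. Then \<open>C C\<^sup>t = 8 I\<close> and the block matrix is
  \<open>(0, C; C\<^sup>t, \<onehalf> C\<^sup>t C - 2 I)\<close>. The columns of \<open>(I; \<onehalf> C\<^sup>t)\<close> are eigenvectors for the eigenvalue 4,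
  and completing them to a basis by the last \<open>2m\<close> unit vectors turns the matrix into the block
  triangular \<open>(4 I, C; 0, -2 I)\<close>, whose diagonal carries the spectrum.
\<close>

section \<open>Products of juxtaposed matrices with their transposes\<close>

lemma append_cols_carrier [simp]:
  "A \<in> carrier_mat n p \<Longrightarrow> B \<in> carrier_mat n q \<Longrightarrow> A @\<^sub>c B \<in> carrier_mat n (p + q)"
  unfolding append_cols_def by auto

text \<open>Each row of the juxtaposition is a row of \<open>A\<close> followed by a row of
  \<open>B\<close>, so inner products of rows split into two summands. For two weighing matrices
  this makes the weights add up.\<close>

lemma append_cols_mult_transpose:
  assumes A: "A \<in> carrier_mat n p" and B: "B \<in> carrier_mat n q"
  shows "(A @\<^sub>c B) * transpose_mat (A @\<^sub>c B) = A * transpose_mat A + B * transpose_mat B"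
    (is "?L = ?R")
proof (rule eq_matI)
  have row: "row (A @\<^sub>c B) i = row A i @\<^sub>v row B i" if "i < n" for i
    unfolding append_cols_def using A B that
    by (intro row_four_block_mat(1)[of A n p B q "0\<^sub>m 0 (dim_col A)" 0]) auto
  fix i j assume "i < dim_row ?R" "j < dim_col ?R"
  then have ij: "i < n" "j < n" using B by auto
  have "?L $$ (i, j) = row (A @\<^sub>c B) i \<bullet> row (A @\<^sub>c B) j"
    using append_cols_carrier[OF A B] ij by auto
  also have "\<dots> = row A i \<bullet> row A j + row B i \<bullet> row B j"
    unfolding row[OF ij(1)] row[OF ij(2)]
    by (rule scalar_prod_append[of _ p _ q]) (use A B in auto)
  also have "\<dots> = ?R $$ (i, j)" using ij A B by auto
  finally show "?L $$ (i, j) = ?R $$ (i, j)" .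
qed (use A B in \<open>auto simp: append_cols_def\<close>)

text \<open>The columns of the juxtaposition are those of \<open>A\<close> followed by those of
  \<open>B\<close>; sorting their inner products by origin gives the four blocks.\<close>

lemma transpose_append_cols_mult:
  assumes A: "A \<in> carrier_mat n p" and B: "B \<in> carrier_mat n q"
  shows "transpose_mat (A @\<^sub>c B) * (A @\<^sub>c B) =
    four_block_mat (transpose_mat A * A) (transpose_mat A * B)
      (transpose_mat B * A) (transpose_mat B * B)" (is "?L = ?R")
proof (rule eq_matI)
  have col: "col (A @\<^sub>c B) j = (if j < p then col A j else col B (j - p))" if "j < p + q" for j
    using A B that by (intro eq_vecI) (auto simp: append_cols_def)
  fix i j assume "i < dim_row ?R" "j < dim_col ?R"
  then have ij: "i < p + q" "j < p + q" using A B by auto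
  then have "?L $$ (i, j) = col (A @\<^sub>c B) i \<bullet> col (A @\<^sub>c B) j"
    using append_cols_carrier[OF A B] by auto
  then show "?L $$ (i, j) = ?R $$ (i, j)"
    using ij A B by (auto simp: col)
qed (use A B in \<open>auto simp: append_cols_def\<close>)

section \<open>Characteristic polynomial of the bordered Gram matrix\<close>

text \<open>The eigenvalue 4 comes from \<open>C C^t = 8 I\<close>. Applied to
  \<open>(I; C^t/2)\<close>, the upper block row gives \<open>C C^t / 2 = 4 I\<close> and the lower
  one \<open>C^t + (C^t C / 2 - 2 I) C^t / 2 = C^t + 2 C^t - C^t = 2 C^t\<close>, which is 4 times
  \<open>C^t / 2\<close>.\<close>

lemma char_poly_bordered_gram:
  fixes C :: "real mat"
  assumes C: "C \<in> carrier_mat m n" and CC: "C * transpose_mat C = 8 \<cdot>\<^sub>m 1\<^sub>m m"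
  shows "char_poly (four_block_mat (0\<^sub>m m m) C (transpose_mat C)
      ((1/2) \<cdot>\<^sub>m (transpose_mat C * C) - 2 \<cdot>\<^sub>m 1\<^sub>m n)) = [:- 4, 1:] ^ m * [:2, 1:] ^ n"
    (is "char_poly ?A = _")
proof -
  let ?t = "transpose_mat C"
  have t: "?t \<in> carrier_mat n m" using C by simp
  \<comment> \<open>The columns of \<open>P\<close> are the eigenvectors followed by the last
    \<open>n\<close> unit vectors, \<open>Q\<close> inverts \<open>P\<close> by negating its lower
    left block, and \<open>T\<close> is the matrix of \<open>?A\<close> in this basis:
    \<open>?A\<close> sends those unit vectors to the columns of \<open>P (C; -2 I)\<close>.\<close>
  define P where "P = four_block_mat (1\<^sub>m m) (0\<^sub>m m n) ((1/2) \<cdot>\<^sub>m ?t) (1\<^sub>m n)"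
  define Q where "Q = four_block_mat (1\<^sub>m m) (0\<^sub>m m n) (- (1/2) \<cdot>\<^sub>m ?t) (1\<^sub>m n)"
  define T where "T = four_block_mat (4 \<cdot>\<^sub>m 1\<^sub>m m) C (0\<^sub>m n m) ((-2) \<cdot>\<^sub>m 1\<^sub>m n)"
  have carr: "P \<in> carrier_mat (m + n) (m + n)" "Q \<in> carrier_mat (m + n) (m + n)"
    "T \<in> carrier_mat (m + n) (m + n)" "?A \<in> carrier_mat (m + n) (m + n)"
    unfolding P_def Q_def T_def using C by auto
  have tt: "(1/2) \<cdot>\<^sub>m ?t + - (1/2) \<cdot>\<^sub>m ?t = 0\<^sub>m n m" "- (1/2) \<cdot>\<^sub>m ?t + (1/2) \<cdot>\<^sub>m ?t = 0\<^sub>m n m"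
    using C by (auto intro!: eq_matI)
  have PQ: "P * Q = 1\<^sub>m (m + n)"
    unfolding P_def Q_def using C
    by (subst mult_four_block_mat[of _ m m _ n _ n _ _ m _ n]) (simp_all add: tt)
  have QP: "Q * P = 1\<^sub>m (m + n)"
    unfolding P_def Q_def using C
    by (subst mult_four_block_mat[of _ m m _ n _ n _ _ m _ n]) (simp_all add: tt)
  \<comment> \<open>The right block column of \<open>P * T\<close> is already that of
    \<open>?A\<close>. Multiplying by \<open>Q\<close> adds this column times
    \<open>- C^t / 2\<close> to the left one, so only the left blocks still change.\<close>
  have PT: "P * T = four_block_mat (4 \<cdot>\<^sub>m 1\<^sub>m m) C (2 \<cdot>\<^sub>m ?t) ((1/2) \<cdot>\<^sub>m (?t * C) - 2 \<cdot>\<^sub>m 1\<^sub>m n)"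
  proof -
    have 1: "(1/2) \<cdot>\<^sub>m ?t * (4 \<cdot>\<^sub>m 1\<^sub>m m) + 1\<^sub>m n * 0\<^sub>m n m = 2 \<cdot>\<^sub>m ?t"
      using t by (subst mult_smult_distrib[of _ n m _ m]) auto
    have 2: "(1/2) \<cdot>\<^sub>m ?t * C + 1\<^sub>m n * ((-2) \<cdot>\<^sub>m 1\<^sub>m n) = (1/2) \<cdot>\<^sub>m (?t * C) - 2 \<cdot>\<^sub>m 1\<^sub>m n"
      using C by (subst mult_smult_assoc_mat[of _ n m]) auto
    have 3: "1\<^sub>m m * (4 \<cdot>\<^sub>m 1\<^sub>m m) + 0\<^sub>m m n * 0\<^sub>m n m = 4 \<cdot>\<^sub>m (1\<^sub>m m :: real mat)"
      by auto
    have 4: "1\<^sub>m m * C + 0\<^sub>m m n * ((-2) \<cdot>\<^sub>m 1\<^sub>m n) = C"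
      using C by auto
    have "P * T = four_block_mat (1\<^sub>m m * (4 \<cdot>\<^sub>m 1\<^sub>m m) + 0\<^sub>m m n * 0\<^sub>m n m)
        (1\<^sub>m m * C + 0\<^sub>m m n * ((-2) \<cdot>\<^sub>m 1\<^sub>m n))
        ((1/2) \<cdot>\<^sub>m ?t * (4 \<cdot>\<^sub>m 1\<^sub>m m) + 1\<^sub>m n * 0\<^sub>m n m)
        ((1/2) \<cdot>\<^sub>m ?t * C + 1\<^sub>m n * ((-2) \<cdot>\<^sub>m 1\<^sub>m n))"
      unfolding P_def T_def by (rule mult_four_block_mat) (use C in auto)
    then show ?thesis unfolding 1 2 3 4 .
  qed
  have PTQ: "P * T * Q = ?A"
  proof -
    let ?D = "(1/2) \<cdot>\<^sub>m (?t * C) - 2 \<cdot>\<^sub>m 1\<^sub>m n"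
    let ?s = "- (1/2) \<cdot>\<^sub>m ?t"
    have D: "?D \<in> carrier_mat n n" using C by (intro minus_carrier_mat) auto
    have s: "?s \<in> carrier_mat n m" using t by simp
    have tC: "?t * C \<in> carrier_mat n n" using C by simp
    \<comment> \<open>By \<open>CC\<close> this product is \<open>-4 I\<close>, which cancels the
      upper left block of \<open>P * T\<close>.\<close>
    have "C * ?s = - (1/2) \<cdot>\<^sub>m (C * ?t)"
      by (rule mult_smult_distrib[OF C t])
    then have 1: "4 \<cdot>\<^sub>m 1\<^sub>m m * 1\<^sub>m m + C * ?s = 0\<^sub>m m m"
      unfolding CC by auto
    \<comment> \<open>Reassociating exposes \<open>C * ?t\<close>, so that \<open>CC\<close> applies
      again.\<close>
    have "?t * C * ?t = ?t * (C * ?t)" by (rule assoc_mult_mat[OF t C t])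
    also have "\<dots> = 8 \<cdot>\<^sub>m ?t" unfolding CC using mult_smult_distrib[OF t one_carrier_mat] t by simp
    finally have tCt: "?t * C * ?t = 8 \<cdot>\<^sub>m ?t" .
    have "?D * ?s = - (1/2) \<cdot>\<^sub>m (?D * ?t)"
      by (rule mult_smult_distrib[OF D t])
    also have "?D * ?t = (1/2) \<cdot>\<^sub>m (?t * C) * ?t - 2 \<cdot>\<^sub>m 1\<^sub>m n * ?t"
      by (rule minus_mult_distrib_mat) (use tC t in auto)
    also have "(1/2) \<cdot>\<^sub>m (?t * C) * ?t = (1/2) \<cdot>\<^sub>m (?t * C * ?t)"
      by (rule mult_smult_assoc_mat[OF tC t])
    also have "2 \<cdot>\<^sub>m 1\<^sub>m n * ?t = 2 \<cdot>\<^sub>m ?t"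
      using mult_smult_assoc_mat[OF one_carrier_mat t] t by simp
    finally have "?D * ?s = - (1/2) \<cdot>\<^sub>m ((1/2) \<cdot>\<^sub>m (8 \<cdot>\<^sub>m ?t) - 2 \<cdot>\<^sub>m ?t)"
      unfolding tCt .
    moreover have "2 \<cdot>\<^sub>m ?t * 1\<^sub>m m = 2 \<cdot>\<^sub>m ?t" using t by simp
    \<comment> \<open>The coefficient of \<open>?t\<close> on the left is 2 - (1/2) (8/2 - 2) =
      1.\<close>
    ultimately have 2: "2 \<cdot>\<^sub>m ?t * 1\<^sub>m m + ?D * ?s = ?t"
      using t by (auto intro!: eq_matI)
    have 3: "4 \<cdot>\<^sub>m 1\<^sub>m m * 0\<^sub>m m n + C * 1\<^sub>m n = C"
      using C by auto
    have 4: "2 \<cdot>\<^sub>m ?t * 0\<^sub>m m n + ?D * 1\<^sub>m n = ?D"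
      using D t by (simp add: right_mult_one_mat[OF D])
    have "P * T * Q = four_block_mat (4 \<cdot>\<^sub>m 1\<^sub>m m * 1\<^sub>m m + C * ?s) (4 \<cdot>\<^sub>m 1\<^sub>m m * 0\<^sub>m m n + C * 1\<^sub>m n)
        (2 \<cdot>\<^sub>m ?t * 1\<^sub>m m + ?D * ?s) (2 \<cdot>\<^sub>m ?t * 0\<^sub>m m n + ?D * 1\<^sub>m n)"
      unfolding PT unfolding Q_def by (rule mult_four_block_mat) (use C s D in auto)
    then show ?thesis unfolding 1 2 3 4 .
  qed
  have "similar_mat_wit ?A T P Q"
    by (rule similar_mat_witI[OF PQ QP PTQ[symmetric] carr(4,3,1,2)])
  then have "char_poly ?A = char_poly T"
    by (intro char_poly_similar) (auto simp: similar_mat_def)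
  also have "\<dots> = (\<Prod>a\<leftarrow>diag_mat T. [:- a, 1:])"
  proof (rule char_poly_upper_triangular[OF carr(3)])
    show "upper_triangular T" unfolding T_def
      by (rule upper_triangular_four_block[of _ m _ n]) auto
  qed
  also have "diag_mat T = diag_mat (4 \<cdot>\<^sub>m 1\<^sub>m m) @ diag_mat ((-2) \<cdot>\<^sub>m 1\<^sub>m n)"
    unfolding T_def by (rule diag_four_block_mat) auto
  also have "diag_mat (4 \<cdot>\<^sub>m 1\<^sub>m m :: real mat) = replicate m 4"
    by (rule nth_equalityI) (auto simp: diag_mat_def)
  also have "diag_mat ((-2) \<cdot>\<^sub>m 1\<^sub>m n :: real mat) = replicate n (-2)"
    by (rule nth_equalityI) (auto simp: diag_mat_def)
  finally show ?thesis by (simp add: map_replicate prod_list_replicate)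
qed

section \<open>From the characteristic polynomial to the spectrum\<close>

lemma proots_two_linear_powers:
  "proots ([:- a, 1:] ^ m * [:- b, 1:] ^ n) = replicate_mset m a + replicate_mset n (b :: 'a :: idom)"
proof -
  have "[:- a, 1:] ^ m \<noteq> 0" "[:- b, 1:] ^ n \<noteq> 0" by auto
  then show ?thesis by (simp add: proots_mult proots_power)
qed

text \<open>The embedding of the reals into the complex numbers is a ring homomorphism and hence
  commutes with forming the characteristic polynomial, so a real factorization carries over to the
  complex matrix.\<close>

lemma mat_spectrum_of_char_poly:
  assumes "A \<in> carrier_mat k k" "char_poly A = [:- a, 1:] ^ m * [:- b, 1:] ^ n"
  shows "mat_spectrum A = replicate_mset m (complex_of_real a) + replicate_mset n (complex_of_real b)"
proof -
  interpret map_poly_comm_ring_hom complex_of_real ..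
  have "char_poly (map_mat complex_of_real A) = map_poly complex_of_real (char_poly A)"
    by (rule of_real_hom.char_poly_hom[OF assms(1)])
  also have "\<dots> = [:- complex_of_real a, 1:] ^ m * [:- complex_of_real b, 1:] ^ n"
    by (simp add: assms(2) hom_mult hom_power)
  finally show ?thesis
    unfolding mat_spectrum_def by (simp add: proots_two_linear_powers)
qed

section \<open>Realising a symmetric matrix by a signed graph\<close>

text \<open>Take the indices as vertices and join the pairs with nonzero entry. Symmetry makes the
  sign independent of the order of the endpoints, and the zero diagonal rules out loops.\<close>

lemma ex_signed_graph_adjacency:
  fixes A :: "real mat"
  assumes A: "A \<in> carrier_mat n n" and sym: "transpose_mat A = A"
    and diag: "\<And>i. i < n \<Longrightarrow> A $$ (i, i) = 0" and elems: "elements_mat A \<subseteq> {0, 1, -1}"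
  shows "\<exists>G :: nat sgraph. signed_graph G \<and> adjacency_mat G = A"
proof -
  \<comment> \<open>A sign is attached to an unordered pair, so \<open>Min\<close> and
    \<open>Max\<close> pick an order of its endpoints. The floor turns the real entry into an
    integer and is exact on 0, 1 and -1.\<close>
  define G where "G = \<lparr>vertices = [0..<n],
    edges = {{i, j} | i j. i < n \<and> j < n \<and> A $$ (i, j) \<noteq> 0},
    edge_sign = (\<lambda>e. \<lfloor>A $$ (Min e, Max e)\<rfloor>)\<rparr>"
  have sym': "A $$ (j, i) = A $$ (i, j)" if "i < n" "j < n" for i j
    using index_transpose_mat(1)[of i A j] sym A that by auto
  have floor_minus_1: "\<lfloor>- 1 :: real\<rfloor> = - 1" by linarith
  have vals: "A $$ (i, j) \<in> {0, 1, -1}" if "i < n" "j < n" for i j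
    using elements_matI[OF A that refl] elems by blast
  have ends: "A $$ (Min {i, j}, Max {i, j}) = A $$ (i, j)" if "i < n" "j < n" for i j
    using sym'[OF that] by (cases "i \<le> j") (auto simp: min_def max_def)
  have edge: "{i, j} \<in> edges G \<longleftrightarrow> A $$ (i, j) \<noteq> 0" if "i < n" "j < n" for i j
    using that sym' unfolding G_def by (auto simp: doubleton_eq_iff)
  have sign: "edge_sign G {i, j} = \<lfloor>A $$ (i, j)\<rfloor>" if "i < n" "j < n" for i j
    unfolding G_def using ends[OF that] by (simp del: Min_insert Max_insert)
  have "signed_graph G"
    unfolding signed_graph_def
  proof (intro conjI ballI)
    fix e assume "e \<in> edges G"
    then obtain i j where ij: "i < n" "j < n" "A $$ (i, j) \<noteq> 0" "e = {i, j}"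
      unfolding G_def by auto
    then have "i \<noteq> j" using diag by auto
    then show "\<exists>u v. u \<in> set (vertices G) \<and> v \<in> set (vertices G) \<and> u \<noteq> v \<and> e = {u, v}"
      using ij unfolding G_def by auto
    show "edge_sign G e \<in> {1, -1}" using vals[OF ij(1,2)] ij(3,4) sign[OF ij(1,2)] floor_minus_1
      by (elim insertE) simp_all
  qed (simp add: G_def)
  moreover have "adjacency_mat G = A"
  proof (rule eq_matI)
    have len: "length (vertices G) = n" by (simp add: G_def)
    have vert: "vertices G ! i = i" if "i < n" for i using that by (simp add: G_def)
    show "dim_row (adjacency_mat G) = dim_row A" "dim_col (adjacency_mat G) = dim_col A"
      using A by (simp_all add: adjacency_mat_def len)
    fix i j assume "i < dim_row A" "j < dim_col A"
    then have ij: "i < n" "j < n" using A by auto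
    then show "adjacency_mat G $$ (i, j) = A $$ (i, j)"
      using vals[OF ij] floor_minus_1
      by (elim insertE) (simp_all add: adjacency_mat_def len vert edge sign)
  qed
  ultimately show ?thesis by blast
qed

section \<open>Block form and size of the adjacency matrix\<close>

text \<open>The Gram matrix of the columns of \<open>(W1 | W2)\<close> has diagonal blocks
  \<open>4 I\<close>. Halving it and subtracting \<open>2 I\<close> clears these blocks and leaves
  half the mixed products off the diagonal.\<close>

lemma block_adjacency_eq:
  assumes "semi_orthogonal m W1 W2"
  shows "block_adjacency m W1 W2 = four_block_mat (0\<^sub>m m m) (W1 @\<^sub>c W2) (transpose_mat (W1 @\<^sub>c W2))
    ((1/2) \<cdot>\<^sub>m (transpose_mat (W1 @\<^sub>c W2) * (W1 @\<^sub>c W2)) - 2 \<cdot>\<^sub>m 1\<^sub>m (2 * m))"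
proof -
  have W: "W1 \<in> carrier_mat m m" "W2 \<in> carrier_mat m m"
    and WW: "transpose_mat W1 * W1 = 4 \<cdot>\<^sub>m 1\<^sub>m m" "transpose_mat W2 * W2 = 4 \<cdot>\<^sub>m 1\<^sub>m m"
    using assms by (auto simp: semi_orthogonal_def weighing_matrix_def)
  have W': "dim_row W1 = m" "dim_col W1 = m" "dim_row W2 = m" "dim_col W2 = m"
    using W by auto
  \<comment> \<open>Naming the mixed products keeps them opaque, so that the entrywise comparison
    does not expand them into inner products.\<close>
  define X where "X = transpose_mat W1 * W2"
  define Y where "Y = transpose_mat W2 * W1"
  have XY: "X \<in> carrier_mat m m" "Y \<in> carrier_mat m m"
    using W by (auto simp: X_def Y_def)
  have X': "dim_row X = m" "dim_col X = m" "dim_row Y = m" "dim_col Y = m"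
    using XY by auto
  show ?thesis
    unfolding transpose_append_cols_mult[OF W] WW X_def[symmetric] Y_def[symmetric]
      block_adjacency_def
    by (rule eq_matI) (auto simp: append_rows_def append_cols_def W' X')
qed

lemma block_adjacency_carrier:
  assumes "semi_orthogonal m W1 W2"
  shows "block_adjacency m W1 W2 \<in> carrier_mat (3 * m) (3 * m)"
proof -
  have "W1 \<in> carrier_mat m m" "W2 \<in> carrier_mat m m"
    using assms by (auto simp: semi_orthogonal_def weighing_matrix_def)
  then show ?thesis
    unfolding block_adjacency_def append_rows_def append_cols_def carrier_mat_def by auto
qed

section \<open>Entries of the block matrix\<close>

lemma elements_mat_append_rows:
  fixes A B :: "'a :: zero mat"
  assumes "dim_col A = dim_col B" "elements_mat A \<subseteq> S" "elements_mat B \<subseteq> S"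
  shows "elements_mat (A @\<^sub>r B) \<subseteq> S"
proof -
  have "elements_mat (A @\<^sub>r B) \<subseteq> elements_mat A \<union> elements_mat (0\<^sub>m (dim_row A) 0) \<union>
      elements_mat B \<union> elements_mat (0\<^sub>m (dim_row B) 0)"
    unfolding append_rows_def by (rule elements_four_block_mat) (use assms(1) in auto)
  \<comment> \<open>The padding blocks in the encoding of \<open>append_rows\<close> have no columns
    and thus contribute no entries.\<close>
  moreover have "elements_mat (0\<^sub>m k 0 :: 'a mat) = {}" for k
    by (simp add: elements_mat_def)
  ultimately show ?thesis using assms(2,3) by blast
qed

lemma elements_mat_append_cols:
  assumes "dim_row A = dim_row B" "elements_mat A \<subseteq> S" "elements_mat B \<subseteq> S"
  shows "elements_mat (A @\<^sub>c B) \<subseteq> S"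
proof -
  have "elements_mat (A @\<^sub>c B) \<subseteq> elements_mat A \<union> elements_mat B \<union>
      elements_mat (0\<^sub>m 0 (dim_col A)) \<union> elements_mat (0\<^sub>m 0 (dim_col B))"
    unfolding append_cols_def by (rule elements_four_block_mat) (use assms(1) in auto)
  moreover have "elements_mat (0\<^sub>m 0 k :: real mat) = {}" for k
    by (simp add: elements_mat_def)
  ultimately show ?thesis using assms(2,3) by blast
qed

lemma elements_mat_transpose_subset: "elements_mat (transpose_mat A) \<subseteq> elements_mat A"
proof
  fix x assume "x \<in> elements_mat (transpose_mat A)"
  then obtain i j where "i < dim_col A" "j < dim_row A" "x = A $$ (j, i)"
    by (auto dest!: elements_matD)
  then show "x \<in> elements_mat A"
    by (intro elements_matI[of A "dim_row A" "dim_col A"]) auto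
qed

lemma elements_mat_smult_subset: "elements_mat (a \<cdot>\<^sub>m A) \<subseteq> (*) a ` elements_mat A"
proof
  fix x assume "x \<in> elements_mat (a \<cdot>\<^sub>m A)"
  then obtain i j where ij: "i < dim_row A" "j < dim_col A" "x = a * A $$ (i, j)"
    by (auto dest!: elements_matD)
  then have "A $$ (i, j) \<in> elements_mat A"
    by (intro elements_matI[of A "dim_row A" "dim_col A"]) auto
  then show "x \<in> (*) a ` elements_mat A" using ij(3) by blast
qed

text \<open>Semi-orthogonality enters here: it makes the halved mixed products take values in 0, 1
  and -1, as a signed graph demands.\<close>

lemma elements_block_adjacency:
  assumes "semi_orthogonal m W1 W2"
  shows "elements_mat (block_adjacency m W1 W2) \<subseteq> {0, 1, -1}"
proof -
  have W: "W1 \<in> carrier_mat m m" "W2 \<in> carrier_mat m m"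
    and eW: "elements_mat W1 \<subseteq> {0, 1, -1}" "elements_mat W2 \<subseteq> {0, 1, -1}"
    and eX: "elements_mat (transpose_mat W1 * W2) \<subseteq> {0, 2, -2}"
    using assms by (auto simp: semi_orthogonal_def weighing_matrix_def)
  \<comment> \<open>The assumption bounds the entries of one mixed product only; the other is its
    transpose.\<close>
  have "transpose_mat W2 * W1 = transpose_mat (transpose_mat W1 * W2)"
    using W by (subst transpose_mult[of _ m m _ m]) auto
  then have eY: "elements_mat (transpose_mat W2 * W1) \<subseteq> {0, 2, -2}"
    using eX elements_mat_transpose_subset[of "transpose_mat W1 * W2"] by auto
  have h: "elements_mat ((1/2) \<cdot>\<^sub>m A) \<subseteq> {0, 1, -1}" if "elements_mat A \<subseteq> {0, 2, -2}" for A :: "real mat"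
    proof -
    have "(*) (1/2) ` elements_mat A \<subseteq> (*) (1/2) ` {0, 2, -2}"
      using that by (rule image_mono)
    also have "\<dots> = {0, 1, -1}" by simp
    finally show ?thesis using elements_mat_smult_subset by (rule subset_trans[rotated])
  qed
  have z: "elements_mat (0\<^sub>m m m) \<subseteq> {0, 1, -1 :: real}"
    using elements_0_mat[of m m] by blast
  have dims: "dim_row W1 = m" "dim_col W1 = m" "dim_row W2 = m" "dim_col W2 = m"
    using W by auto
  have t: "elements_mat (transpose_mat W1) \<subseteq> {0, 1, -1}" "elements_mat (transpose_mat W2) \<subseteq> {0, 1, -1}"
    by (rule subset_trans[OF elements_mat_transpose_subset], rule eW)+
  note cols = elements_mat_append_cols and rows = elements_mat_append_rows
  note d = append_rows_def append_cols_def dims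
  have 1: "elements_mat (0\<^sub>m m m @\<^sub>c W1 @\<^sub>c W2) \<subseteq> {0, 1, -1}"
    by (rule cols[OF _ z cols[OF _ eW]]) (simp_all add: d)
  have 2: "elements_mat (transpose_mat W1 @\<^sub>c 0\<^sub>m m m @\<^sub>c ((1/2) \<cdot>\<^sub>m (transpose_mat W1 * W2)))
      \<subseteq> {0, 1, -1}"
    by (rule cols[OF _ t(1) cols[OF _ z h[OF eX]]]) (simp_all add: d)
  have 3: "elements_mat (transpose_mat W2 @\<^sub>c ((1/2) \<cdot>\<^sub>m (transpose_mat W2 * W1)) @\<^sub>c 0\<^sub>m m m)
      \<subseteq> {0, 1, -1}"
    by (rule cols[OF _ t(2) cols[OF _ h[OF eY] z]]) (simp_all add: d)
  show ?thesis
    unfolding block_adjacency_def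
    by (rule rows[OF _ 1 rows[OF _ 2 3]]) (simp_all add: d)
qed

section \<open>The signed graph and its spectrum\<close>

text \<open>Existence is stated over the natural numbers, because an arbitrary vertex type could
  have fewer than \<open>3 * m\<close> elements. The spectrum depends only on the matrix and is
  therefore claimed for every realisation over any type.\<close>

theorem theorem3p7:
  fixes m :: nat and W1 W2 :: "real mat"
  assumes "semi_orthogonal m W1 W2"
  shows "(\<exists>G :: nat sgraph. signed_graph G \<and> adjacency_mat G = block_adjacency m W1 W2) \<and>
         (\<forall>G :: 'v sgraph. signed_graph G \<and> adjacency_mat G = block_adjacency m W1 W2 \<longrightarrow>
            graph_spectrum G = replicate_mset m 4 + replicate_mset (2 * m) (-2))"
proof (intro conjI allI impI)
  let ?A = "block_adjacency m W1 W2" and ?C = "W1 @\<^sub>c W2"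
  let ?D = "(1/2) \<cdot>\<^sub>m (transpose_mat ?C * ?C) - 2 \<cdot>\<^sub>m 1\<^sub>m (2 * m)"
  have W: "W1 \<in> carrier_mat m m" "W2 \<in> carrier_mat m m"
    and WW: "W1 * transpose_mat W1 = 4 \<cdot>\<^sub>m 1\<^sub>m m" "W2 * transpose_mat W2 = 4 \<cdot>\<^sub>m 1\<^sub>m m"
    using assms by (auto simp: semi_orthogonal_def weighing_matrix_def)
  have C: "?C \<in> carrier_mat m (2 * m)"
    using append_cols_carrier[OF W] by (simp add: mult_2)
  \<comment> \<open>The constant 8 is the sum of the two weights 4.\<close>
  have CC: "?C * transpose_mat ?C = 8 \<cdot>\<^sub>m 1\<^sub>m m"
    unfolding append_cols_mult_transpose[OF W] WW by (auto intro!: eq_matI)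
  note A = block_adjacency_carrier[OF assms] and A_eq = block_adjacency_eq[OF assms]
  show "\<exists>G :: nat sgraph. signed_graph G \<and> adjacency_mat G = ?A"
  proof (rule ex_signed_graph_adjacency[OF A _ _ elements_block_adjacency[OF assms]])
    \<comment> \<open>Symmetry of the whole matrix reduces to that of \<open>?D\<close>, hence to
      that of a Gram matrix.\<close>
    have G: "transpose_mat (transpose_mat ?C * ?C) = transpose_mat ?C * ?C"
      using C by (subst transpose_mult[of _ "2 * m" m _ "2 * m"]) auto
    have "transpose_mat ?D = (1/2) \<cdot>\<^sub>m transpose_mat (transpose_mat ?C * ?C) - 2 \<cdot>\<^sub>m 1\<^sub>m (2 * m)"
      using C by (intro eq_matI) auto
    then have "transpose_mat ?D = ?D" unfolding G .
    then show "transpose_mat ?A = ?A"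
      unfolding A_eq using C by (subst transpose_four_block_mat[of _ m m _ "2 * m" _ "2 * m"]) auto
    have dims: "dim_row W1 = m" "dim_col W1 = m" "dim_row W2 = m" "dim_col W2 = m"
      using W by auto
    \<comment> \<open>Every diagonal position lies in one of the three zero blocks.\<close>
    fix i assume "i < 3 * m"
    then show "?A $$ (i, i) = 0"
      by (auto simp: block_adjacency_def append_rows_def append_cols_def dims)
  qed
  fix G :: "'v sgraph"
  assume "signed_graph G \<and> adjacency_mat G = ?A"
  \<comment> \<open>The factor \<open>[:2, 1:]\<close> is rewritten as \<open>[:- (- 2), 1:]\<close>
    to display the root -2.\<close>
  moreover have "char_poly ?A = [:- 4, 1:] ^ m * [:- (- 2), 1:] ^ (2 * m)"
    unfolding A_eq using char_poly_bordered_gram[OF C CC] by simp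
  ultimately show "graph_spectrum G = replicate_mset m 4 + replicate_mset (2 * m) (-2)"
    using mat_spectrum_of_char_poly[OF A, of 4 m "- 2" "2 * m"] by (simp add: graph_spectrum_def)
qed

end
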